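(* Let $\mathbb{A}\colon\mathbb{R}^n\rightrightarrows\mathbb{R}^n$ be maximal $\mu$-strongly monotone with $\mu\ge 0$. Assume $\mathbb{A}$ has a zero and let $x_\star\in\mathrm{Zer}\,\mathbb{A}$. Let $\varphi_k=\sum_{i=0}^k(1+2\mu)^{2i}$ for $k\ge 0$ and $\varphi_{-1}=0$, let $x_0=y_0=y_{-1}\in\mathbb{R}^n$ be a starting point, and let (OS-PPM) be the iteration, for $k=1,2,\dots$, \[ x_k=\mathbb{J}_{\mathbb{A}}y_{k-1}, \] \[ y_k=x_k+\frac{\varphi_{k-1}-1}{\varphi_k}(x_k-x_{k-1})-\frac{2\mu\varphi_{k-1}}{\varphi_k}(y_{k-1}-x_k)+\frac{(1+2\mu)\varphi_{k-2}}{\varphi_k}(y_{k-2}-x_{k-1}). \] Then for every $N=1,2,\dots$, \[ \|\tilde{\mathbb{A}}x_N\|^2\le\left(\frac{1}{\sum_{k=0}^{N-1}(1+2\mu)^k}\right)^2\|y_0-x_\star\|^2, \] where $\tilde{\mathbb{A}}x_N=y_{N-1}-x_N$.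
   Context: $\mathbb{R}^n$ carries the standard inner product and norm. A set-valued operator $\mathbb{A}\colon\mathbb{R}^n\rightrightarrows\mathbb{R}^n$ is $\mu$-strongly monotone if $\langle u-v,x-y\rangle\ge\mu\|x-y\|^2$ for all $x,y$, $u\in\mathbb{A}x$, $v\in\mathbb{A}y$ ($\mu=0$: monotone); it is maximal if its graph is not properly contained in the graph of another $\mu$-strongly monotone operator. $\mathrm{Zer}\,\mathbb{A}=\{x: 0\in\mathbb{A}x\}$. $\mathbb{J}_{\mathbb{A}}=(\mathbb{I}+\mathbb{A})^{-1}$ is the resolvent, which for such $\mathbb{A}$ is single-valued and defined on all of $\mathbb{R}^n$. $\tilde{\mathbb{A}}x=y-\mathbb{J}_{\mathbb{A}}y\in\mathbb{A}x$ denotes the resolvent residual at $x=\mathbb{J}_{\mathbb{A}}y$. *)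

theory Defs
  imports "HOL-Analysis.Analysis"
begin

text \<open>A set-valued operator on \<open>\<real>\<^sup>n\<close> is a function from points to sets of points.\<close>

type_synonym 'n set_op = "real ^ 'n \<Rightarrow> (real ^ 'n) set"

definition graph_op :: "'n::finite set_op \<Rightarrow> ((real ^ 'n) \<times> (real ^ 'n)) set" where
  "graph_op A = {(x, u). u \<in> A x}"

definition strongly_monotone :: "real \<Rightarrow> 'n::finite set_op \<Rightarrow> bool" where
  "strongly_monotone \<mu> A \<longleftrightarrow>
     (\<forall>x y. \<forall>u\<in>A x. \<forall>v\<in>A y. (u - v) \<bullet> (x - y) \<ge> \<mu> * (norm (x - y))\<^sup>2)"

text \<open>Maximality is among \<open>\<mu>\<close>-strongly monotone operators with the same \<open>\<mu>\<close>.\<close>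

definition maximal_strongly_monotone :: "real \<Rightarrow> 'n::finite set_op \<Rightarrow> bool" where
  "maximal_strongly_monotone \<mu> A \<longleftrightarrow>
     strongly_monotone \<mu> A \<and>
     \<not> (\<exists>B. strongly_monotone \<mu> B \<and> graph_op A \<subset> graph_op B)"

definition Zer :: "'n::finite set_op \<Rightarrow> (real ^ 'n) set" where
  "Zer A = {x. 0 \<in> A x}"

definition id_plus_op :: "'n::finite set_op \<Rightarrow> 'n set_op" where
  "id_plus_op A x = (\<lambda>u. x + u) ` A x"

definition inverse_op :: "'n::finite set_op \<Rightarrow> 'n set_op" where
  "inverse_op A y = {x. y \<in> A x}"

text \<open>The resolvent \<open>(I + A)\<^sup>-\<^sup>1\<close> as a point-valued map. It is meaningful where the set-valued
  inverse is a singleton, which by Minty's theorem is everywhere if \<open>A\<close> is maximal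
  \<open>\<mu>\<close>-strongly monotone with \<open>\<mu> \<ge> 0\<close>.\<close>

definition resolvent :: "'n::finite set_op \<Rightarrow> real ^ 'n \<Rightarrow> real ^ 'n" where
  "resolvent A y = (THE x. x \<in> inverse_op (id_plus_op A) y)"

text \<open>Indices are integers so that index \<open>-1\<close> is available; \<open>phi \<mu> (-1)\<close> is an empty sum,
  hence \<open>0\<close>.\<close>

definition phi :: "real \<Rightarrow> int \<Rightarrow> real" where
  "phi \<mu> k = (\<Sum>i = 0..k. (1 + 2 * \<mu>) ^ (2 * nat i))"

text \<open>Only \<open>x k\<close> for \<open>k \<ge> 0\<close> and \<open>y k\<close> for \<open>k \<ge> -1\<close> are constrained.\<close>

definition OS_PPM ::
  "real \<Rightarrow> 'n::finite set_op \<Rightarrow> (int \<Rightarrow> real ^ 'n) \<Rightarrow> (int \<Rightarrow> real ^ 'n) \<Rightarrow> bool" where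
  "OS_PPM \<mu> A x y \<longleftrightarrow>
     x 0 = y 0 \<and> y 0 = y (-1) \<and>
     (\<forall>k\<ge>1.
        x k = resolvent A (y (k - 1)) \<and>
        y k = x k
          + ((phi \<mu> (k - 1) - 1) / phi \<mu> k) *\<^sub>R (x k - x (k - 1))
          - (2 * \<mu> * phi \<mu> (k - 1) / phi \<mu> k) *\<^sub>R (y (k - 1) - x k)
          + ((1 + 2 * \<mu>) * phi \<mu> (k - 2) / phi \<mu> k) *\<^sub>R (y (k - 2) - x (k - 1)))"

end

theory Submission
  imports Defs
begin

text \<open>Put \<open>g = 1 + 2\<mu>\<close> and \<open>T y = x - (y - x) / g\<close> with \<open>x = J y\<close>, where \<open>J\<close> is the resolvent of \<open>A\<close>.
  Strong monotonicity of \<open>A\<close> says that \<open>T\<close> is a contraction with factor \<open>1 / g\<close>, and the iteration is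
  the Halpern scheme \<open>y\<^sub>k = (1 - 1 / \<phi>\<^sub>k) T y\<^sub>k\<^sub>-\<^sub>1 + y\<^sub>0 / \<phi>\<^sub>k\<close>. With \<open>z = y\<^sub>k\<^sub>-\<^sub>1 - y\<^sub>0\<close> and
  \<open>t = T y\<^sub>k\<^sub>-\<^sub>1 - y\<^sub>0\<close> the inequality \<open>\<phi>\<^sub>k\<^sub>-\<^sub>1 \<parallel>t - z\<parallel>\<^sup>2 + \<parallel>z\<parallel>\<^sup>2 / g\<^sup>2 \<le> \<parallel>t\<parallel>\<^sup>2\<close> is preserved: its successor is a
  nonnegative combination of itself and the contraction inequality for \<open>y\<^sub>k\<^sub>-\<^sub>1, y\<^sub>k\<close>. Adding \<open>g\<^sup>N\<close> times the
  contraction inequality at the zero of \<open>A\<close> and completing a square gives the rate. That \<open>x\<close> is a genuine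
  resolvent value is Minty's theorem, obtained here without fixed point theorems from the minimum of a finite
  maximum of quadratics, compactness, and maximality of \<open>A\<close>.\<close>

subsection \<open>Surjectivity of \<open>I + A\<close>\<close>

lemma continuous_on_Max:
  fixes f :: "'i \<Rightarrow> 'a::topological_space \<Rightarrow> 'b::linorder_topology"
  assumes "finite I" "I \<noteq> {}" "\<And>i. i \<in> I \<Longrightarrow> continuous_on X (f i)"
  shows "continuous_on X (\<lambda>x. Max ((\<lambda>i. f i x) ` I))"
  using assms
proof (induction I rule: finite_ne_induct)
  case (insert i I)
  then have "continuous_on X (\<lambda>x. max (f i x) (Max ((\<lambda>i. f i x) ` I)))"
    by (intro continuous_on_max) auto
  then show ?case using insert by simp
qed simp

text \<open>Minimise over \<open>x\<close> the maximum of \<open>w\<^sub>p \<bullet> b\<^sub>p\<close>, where \<open>w\<^sub>p = x - y + u + c (x - a)\<close> and \<open>b\<^sub>p = x - a\<close> for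
  \<open>p = (a, u)\<close>. At the minimum \<open>x0\<close> the gradients \<open>w\<^sub>p + (1 + c) b\<^sub>p\<close> of the active terms have \<open>0\<close> in their convex
  hull, so some convex combination \<open>(W, B)\<close> of the active pairs \<open>(w\<^sub>p, b\<^sub>p)\<close> has \<open>W = - (1 + c) B\<close>. Monotonicity
  makes the minimal value at most \<open>W \<bullet> B \<le> 0\<close>.\<close>

lemma strongly_monotone_finite_extension:
  fixes S :: "('a::euclidean_space \<times> 'a) set" and y :: 'a and c :: real
  assumes fin: "finite S" and c: "c \<ge> 0"
    and mono: "\<And>a u b v. (a, u) \<in> S \<Longrightarrow> (b, v) \<in> S \<Longrightarrow> c * (norm (a - b))\<^sup>2 \<le> (u - v) \<bullet> (a - b)"
  shows "\<exists>x. \<forall>(a, u) \<in> S. c * (norm (x - a))\<^sup>2 \<le> (y - x - u) \<bullet> (x - a)"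
proof (cases "S = {}")
  case False
  define w where "w = (\<lambda>(p::'a \<times> 'a) x. x - y + snd p + c *\<^sub>R (x - fst p) :: 'a)"
  define b where "b = (\<lambda>(p::'a \<times> 'a) x. x - fst p)"
  define F where "F = (\<lambda>x. Max ((\<lambda>p. w p x \<bullet> b p x) ` S))"
  have F_ge: "w p x \<bullet> b p x \<le> F x" if "p \<in> S" for p x
    unfolding F_def using fin that by (intro Max_ge) auto
  have F_attained: "\<exists>p\<in>S. F x = w p x \<bullet> b p x" for x
    using Max_in[of "(\<lambda>p. w p x \<bullet> b p x) ` S"] fin False
    unfolding F_def by (metis (no_types, lifting) finite_imageI image_iff image_is_empty)
  have contF: "continuous_on X F" for X
    unfolding F_def w_def b_def using fin False by (intro continuous_on_Max continuous_intros) auto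
  obtain p0 where p0: "p0 \<in> S" using False by blast
  \<comment> \<open>Outside the ball of radius \<open>R\<close> the quadratic of the single pair
    \<open>p0\<close> already exceeds \<open>F 0\<close>, so the minimum over the ball, which exists
    by compactness, is global.\<close>
  obtain R where R: "\<And>x. norm x > R \<Longrightarrow> F 0 < w p0 x \<bullet> b p0 x" "R \<ge> 0"
  proof -
    define R where "R = 2 + norm (fst p0) + norm (snd p0 - y + fst p0) + \<bar>F 0\<bar>"
    have "F 0 < w p0 x \<bullet> b p0 x" if "norm x > R" for x
    proof -
      define d where "d = x - fst p0"
      define v where "v = snd p0 - y + fst p0"
      have "norm x \<le> norm d + norm (fst p0)"
        unfolding d_def using norm_triangle_sub[of x "fst p0"] by simp
      then have d: "norm d \<ge> 2 + norm v + \<bar>F 0\<bar>" using that by (simp add: R_def v_def)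
      then have d1: "norm d \<ge> 1" using norm_ge_zero[of v] by linarith
      have "w p0 x \<bullet> b p0 x = (1 + c) * (norm d)\<^sup>2 + v \<bullet> d"
        unfolding w_def b_def d_def v_def power2_norm_eq_inner
        by (simp add: algebra_simps inner_add_left inner_diff_left inner_add_right inner_diff_right inner_commute)
      moreover have "v \<bullet> d \<ge> - (norm v * norm d)"
        using Cauchy_Schwarz_ineq2[of v d] by linarith
      moreover have "(1 + c) * (norm d)\<^sup>2 \<ge> (norm d)\<^sup>2" using c by (simp add: algebra_simps)
      moreover have "(norm d)\<^sup>2 \<ge> (2 + norm v + \<bar>F 0\<bar>) * norm d"
        unfolding power2_eq_square using d by (intro mult_right_mono) auto
      moreover have "\<bar>F 0\<bar> * norm d \<ge> \<bar>F 0\<bar> * 1" using d1 by (intro mult_left_mono) auto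
      ultimately show ?thesis using d1 unfolding distrib_right by linarith
    qed
    moreover have "R \<ge> 0" by (simp add: R_def)
    ultimately show ?thesis using that by blast
  qed
  obtain x0 where x0: "x0 \<in> cball 0 R" "\<And>x. x \<in> cball 0 R \<Longrightarrow> F x0 \<le> F x"
    using continuous_attains_inf[OF compact_cball _ contF, of 0 R] R by fastforce
  have min: "F x0 \<le> F x" for x
  proof (cases "norm x \<le> R")
    case False
    have "F x0 \<le> F 0" using x0 R by simp
    with R(1)[of x] F_ge[OF p0, of x] False show ?thesis by simp
  qed (use x0 in auto)
  define P where "P = {p \<in> S. w p x0 \<bullet> b p x0 = F x0}"
  define Q where "Q = (\<lambda>p. (w p x0, b p x0)) ` P"
  \<comment> \<open>\<open>l\<close> sends an active pair to its gradient. Being linear, it commutes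
    with convex hulls, so \<open>0\<close> in the hull of the gradients lifts to some
    \<open>(W, B)\<close> in the hull of the pairs.\<close>
  define l where "l = (\<lambda>(w, b). w + (1 + c) *\<^sub>R b :: 'a)"
  have lin: "linear l"
    unfolding l_def by (rule linearI) (auto simp: algebra_simps)
  have "0 \<in> convex hull (l ` Q)"
  proof (rule ccontr)
    assume "0 \<notin> convex hull (l ` Q)"
    moreover have "finite (l ` Q)" using fin by (auto simp: Q_def P_def)
    ultimately obtain d e where d: "e > 0" "\<And>x. x \<in> convex hull (l ` Q) \<Longrightarrow> e < d \<bullet> x"
      using separating_hyperplane_closed_0[of "convex hull (l ` Q)"]
      by (meson compact_imp_closed convex_convex_hull finite_imp_compact_convex_hull)
    \<comment> \<open>\<open>h p\<close> follows the term of \<open>p\<close> along the direction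
      \<open>- d\<close>. Active terms have negative slope at \<open>0\<close>, and inactive ones
      stay below \<open>F x0\<close> by continuity, so a small step would contradict
      minimality.\<close>
    define h where "h = (\<lambda>p t. w p (x0 - t *\<^sub>R d) \<bullet> b p (x0 - t *\<^sub>R d))"
    have h_eq: "h p t = h p 0 - t * (d \<bullet> l (w p x0, b p x0) - t * ((1 + c) * (d \<bullet> d)))" for p t
      unfolding h_def l_def w_def b_def
      by (simp add: algebra_simps inner_add_left inner_diff_left inner_add_right inner_diff_right inner_commute)
    have "\<forall>\<^sub>F t in at_right 0. h p t < F x0" if "p \<in> S" for p
    proof (cases "p \<in> P")
      case True
      then have "(w p x0, b p x0) \<in> Q" by (simp add: Q_def)
      then have pos: "d \<bullet> l (w p x0, b p x0) > 0"
        using d by (meson hull_inc image_eqI less_trans)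
      have "((\<lambda>t. d \<bullet> l (w p x0, b p x0) - t * ((1 + c) * (d \<bullet> d))) \<longlongrightarrow> d \<bullet> l (w p x0, b p x0) - 0 * ((1 + c) * (d \<bullet> d))) (at_right 0)"
        by (intro tendsto_intros)
      then have "\<forall>\<^sub>F t in at_right 0. d \<bullet> l (w p x0, b p x0) - t * ((1 + c) * (d \<bullet> d)) > 0"
        using pos by (intro order_tendstoD(1)) auto
      moreover have "\<forall>\<^sub>F t::real in at_right 0. t > 0" by (simp add: eventually_at_right_less)
      ultimately show ?thesis
      proof eventually_elim
        case (elim t)
        then have "h p t < h p 0" unfolding h_eq[of p t] by simp
        with True show ?case by (simp add: h_def P_def)
      qed
    next
      case False
      then have "h p 0 < F x0"
        using F_ge[OF that, of x0] that by (simp add: P_def h_def)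
      moreover have "((\<lambda>t. h p 0 - t * (d \<bullet> l (w p x0, b p x0) - t * ((1 + c) * (d \<bullet> d)))) \<longlongrightarrow>
          h p 0 - 0 * (d \<bullet> l (w p x0, b p x0) - 0 * ((1 + c) * (d \<bullet> d)))) (at_right 0)"
        by (intro tendsto_intros)
      then have "(h p \<longlongrightarrow> h p 0) (at_right 0)"
        unfolding h_eq[symmetric] by simp
      ultimately show ?thesis by (intro order_tendstoD(2)) auto
    qed
    then have "\<forall>\<^sub>F t in at_right 0. \<forall>p\<in>S. h p t < F x0"
      using fin by (intro eventually_ball_finite) auto
    then obtain t where t: "\<forall>p\<in>S. h p t < F x0"
      using eventually_happens'[OF trivial_limit_at_right_real] by blast
    obtain p where "p \<in> S" "F (x0 - t *\<^sub>R d) = h p t"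
      using F_attained unfolding h_def by blast
    with t min[of "x0 - t *\<^sub>R d"] show False by auto
  qed
  then obtain W B where WB: "(W, B) \<in> convex hull Q" "W + (1 + c) *\<^sub>R B = 0"
    unfolding convex_hull_linear_image[OF lin, symmetric] by (auto simp: l_def)
  \<comment> \<open>Monotonicity between two active pairs, in polarised form. The right-hand side is
    linear in each pair separately, so passing to the hull in one argument and then in the other
    yields \<open>F x0 \<le> W \<bullet> B\<close>.\<close>
  have pair: "2 * F x0 \<le> w1 \<bullet> b2 + w2 \<bullet> b1" if "(w1, b1) \<in> Q" "(w2, b2) \<in> Q" for w1 b1 w2 b2
  proof -
    from that obtain p q where p: "p \<in> P" "w1 = w p x0" "b1 = b p x0"
      and q: "q \<in> P" "w2 = w q x0" "b2 = b q x0" by (auto simp: Q_def)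
    have "c * (norm (fst p - fst q))\<^sup>2 \<le> (snd p - snd q) \<bullet> (fst p - fst q)"
      using mono[of "fst p" "snd p" "fst q" "snd q"] p q by (simp add: P_def)
    moreover have "(w1 - w2) \<bullet> (b1 - b2) = c * (norm (fst p - fst q))\<^sup>2 - (snd p - snd q) \<bullet> (fst p - fst q)"
      unfolding p q w_def b_def power2_norm_eq_inner
      by (simp add: algebra_simps inner_add_left inner_diff_left inner_add_right inner_diff_right inner_commute)
    ultimately have "(w1 - w2) \<bullet> (b1 - b2) \<le> 0" by simp
    moreover have "w1 \<bullet> b1 = F x0" "w2 \<bullet> b2 = F x0" using p q by (auto simp: P_def)
    ultimately show ?thesis by (simp add: inner_diff_left inner_diff_right)
  qed
  have half: "convex {p. 2 * F x0 \<le> w1 \<bullet> snd p + fst p \<bullet> b1}" for w1 b1 :: 'a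
    using convex_halfspace_ge[of "2 * F x0" "(b1, w1)"]
    by (simp add: inner_prod_def inner_commute add.commute)
  have "convex hull Q \<subseteq> {p. 2 * F x0 \<le> w1 \<bullet> snd p + fst p \<bullet> b1}" if "(w1, b1) \<in> Q" for w1 b1
    using half pair that by (intro hull_minimal) auto
  with WB have "2 * F x0 \<le> w1 \<bullet> B + W \<bullet> b1" if "(w1, b1) \<in> Q" for w1 b1
    using that by fastforce
  then have "convex hull Q \<subseteq> {p. 2 * F x0 \<le> W \<bullet> snd p + fst p \<bullet> B}"
    using half by (intro hull_minimal) (auto simp: add.commute)
  with WB have "2 * F x0 \<le> 2 * (W \<bullet> B)" by auto
  also have "W = - ((1 + c) *\<^sub>R B)" using WB by (simp add: add_eq_0_iff2)
  also have "2 * (- ((1 + c) *\<^sub>R B) \<bullet> B) \<le> 0" using c by simp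
  finally have "w p x0 \<bullet> b p x0 \<le> 0" if "p \<in> S" for p
    using F_ge[OF that, of x0] by simp
  then have "\<forall>(a, u) \<in> S. c * (norm (x0 - a))\<^sup>2 \<le> (y - x0 - u) \<bullet> (x0 - a)"
    by (fastforce simp: w_def b_def power2_norm_eq_inner algebra_simps inner_add_left inner_diff_left inner_add_right inner_diff_right)
  then show ?thesis by blast
qed simp

text \<open>Each graph pair confines \<open>x\<close> to a compact set \<open>C p\<close>. Finitely
  many of these sets meet, hence all do. Adjoining \<open>(x, y - x)\<close> to the graph for a
  common point \<open>x\<close> keeps strong monotonicity, so maximality puts it there
  already.\<close>

lemma maximal_strongly_monotone_residual_exists:
  fixes A :: "real ^ 'n::finite \<Rightarrow> (real ^ 'n) set"
  assumes \<mu>: "\<mu> \<ge> 0" and A: "maximal_strongly_monotone \<mu> A"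
  shows "\<exists>x. y - x \<in> A x"
proof -
  define C where "C = (\<lambda>(a, u). {x. \<mu> * (norm (x - a))\<^sup>2 \<le> (y - x - u) \<bullet> (x - a)})"
  have mono: "strongly_monotone \<mu> A"
    and max: "\<And>B. strongly_monotone \<mu> B \<Longrightarrow> graph_op A \<subseteq> graph_op B \<Longrightarrow> graph_op B = graph_op A"
    using A by (auto simp: maximal_strongly_monotone_def)
  have mono': "\<mu> * (norm (a - b))\<^sup>2 \<le> (u - v) \<bullet> (a - b)"
    if "(a, u) \<in> graph_op A" "(b, v) \<in> graph_op A" for a u b v
    using mono that by (auto simp: strongly_monotone_def graph_op_def)
  have closed: "closed (C p)" for p
    unfolding C_def case_prod_beta by (intro closed_Collect_le continuous_intros)
  have bounded: "bounded (C p)" for p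
  proof -
    have "norm (x - fst p) \<le> norm (y - fst p - snd p)" if "x \<in> C p" for x
    proof -
      have "0 \<le> (y - x - snd p) \<bullet> (x - fst p)"
        using that \<mu> by (auto simp: C_def case_prod_beta intro: order_trans[rotated])
      then have "(norm (x - fst p))\<^sup>2 \<le> (y - fst p - snd p) \<bullet> (x - fst p)"
        unfolding power2_norm_eq_inner by (simp add: inner_diff_left)
      also have "\<dots> \<le> norm (y - fst p - snd p) * norm (x - fst p)"
        by (rule norm_cauchy_schwarz)
      finally show ?thesis
        by (cases "norm (x - fst p) = 0") (auto simp: power2_eq_square)
    qed
    then have "C p \<subseteq> cball (fst p) (norm (y - fst p - snd p))"
      by (auto simp: dist_norm norm_minus_commute)
    then show ?thesis using bounded_cball bounded_subset by blast
  qed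
  have fin: "\<exists>x. \<forall>p\<in>S. x \<in> C p" if "finite S" "S \<subseteq> graph_op A" for S
    using strongly_monotone_finite_extension[OF that(1) \<mu>, of y] mono' that(2)
    by (fastforce simp: C_def)
  have "\<exists>x. \<forall>p\<in>graph_op A. x \<in> C p"
  proof (cases "graph_op A = {}")
    case False
    then obtain p where p: "p \<in> graph_op A" by blast
    have "C p \<inter> (\<Inter>q\<in>graph_op A. C q) \<noteq> {}"
    proof (rule compact_imp_fip_image)
      show "compact (C p)" using closed bounded by (simp add: compact_eq_bounded_closed)
      fix S assume "finite S" "S \<subseteq> graph_op A"
      then show "C p \<inter> (\<Inter>q\<in>S. C q) \<noteq> {}"
        using fin[of "insert p S"] p by auto
    qed (rule closed)
    then show ?thesis by auto
  qed simp
  then obtain x where x: "\<And>a u. (a, u) \<in> graph_op A \<Longrightarrow> \<mu> * (norm (x - a))\<^sup>2 \<le> (y - x - u) \<bullet> (x - a)"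
    by (fastforce simp: C_def)
  define B where "B = A(x := insert (y - x) (A x))"
  have B: "graph_op B = insert (x, y - x) (graph_op A)"
    by (auto simp: B_def graph_op_def split: if_splits)
  have "strongly_monotone \<mu> B"
  proof -
    have "\<mu> * (norm (a - b))\<^sup>2 \<le> (u - v) \<bullet> (a - b)"
      if "(a, u) \<in> graph_op B" "(b, v) \<in> graph_op B" for a u b v
    proof -
      have "(u - v) \<bullet> (a - b) = (v - u) \<bullet> (b - a)"
        by (simp add: inner_diff_left inner_diff_right)
      then show ?thesis
        using that x[of a u] x[of b v] mono'[of a u b v]
        unfolding B by (auto simp: norm_minus_commute)
    qed
    then show ?thesis by (simp add: strongly_monotone_def graph_op_def)
  qed
  then have "(x, y - x) \<in> graph_op A" using max[of B] B by blast
  then show ?thesis by (auto simp: graph_op_def)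
qed

text \<open>Justifies the definite description in \<open>resolvent\<close>: the residuals of two
  solutions differ by \<open>- (x' - x)\<close>, which monotonicity allows only if
  \<open>x' = x\<close>.\<close>

lemma resolvent_residual_mem:
  fixes A :: "real ^ 'n::finite \<Rightarrow> (real ^ 'n) set"
  assumes \<mu>: "\<mu> \<ge> 0" and A: "maximal_strongly_monotone \<mu> A"
  shows "y - resolvent A y \<in> A (resolvent A y)"
proof -
  have mem: "x \<in> inverse_op (id_plus_op A) y \<longleftrightarrow> y - x \<in> A x" for x
    by (force simp: inverse_op_def id_plus_op_def)
  obtain x where x: "y - x \<in> A x" using maximal_strongly_monotone_residual_exists[OF assms] by blast
  have "x' = x" if "y - x' \<in> A x'" for x'
  proof -
    have "\<mu> * (norm (x' - x))\<^sup>2 \<le> (y - x' - (y - x)) \<bullet> (x' - x)"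
      using A that x unfolding maximal_strongly_monotone_def strongly_monotone_def by blast
    also have "\<dots> = - (norm (x' - x))\<^sup>2"
      by (simp add: power2_norm_eq_inner inner_diff_left inner_diff_right)
    finally have "(norm (x' - x))\<^sup>2 \<le> 0"
      using \<mu> by (smt (verit) mult_nonneg_nonneg zero_le_power2)
    then show ?thesis by simp
  qed
  then have "resolvent A y = x"
    unfolding resolvent_def mem using x by blast
  then show ?thesis using x by simp
qed

subsection \<open>Anchored contractions\<close>

lemma reflected_resolvent_contraction:
  fixes x x' r r' :: "'a::real_inner"
  assumes "\<mu> \<ge> 0" and "\<mu> * (norm (x - x'))\<^sup>2 \<le> (r - r') \<bullet> (x - x')"
  defines "g \<equiv> 1 + 2 * \<mu>"
  shows "g\<^sup>2 * (norm ((x - r /\<^sub>R g) - (x' - r' /\<^sub>R g)))\<^sup>2 \<le> (norm ((x + r) - (x' + r')))\<^sup>2"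
proof -
  define X R where "X = x - x'" and "R = r - r'"
  have g: "g > 0" using assms by (simp add: g_def)
  have "g\<^sup>2 * (norm ((x - r /\<^sub>R g) - (x' - r' /\<^sub>R g)))\<^sup>2 = (norm (g *\<^sub>R ((x - r /\<^sub>R g) - (x' - r' /\<^sub>R g))))\<^sup>2"
    by (simp add: power_mult_distrib)
  also have "g *\<^sub>R ((x - r /\<^sub>R g) - (x' - r' /\<^sub>R g)) = g *\<^sub>R X - R"
    using g by (simp add: X_def R_def algebra_simps)
  \<comment> \<open>The gap is exactly \<open>4 * (1 + \<mu>)\<close> times the slack in the strong
    monotonicity inequality.\<close>
  also have "(norm (g *\<^sub>R X - R))\<^sup>2 = (norm (X + R))\<^sup>2 - 4 * (1 + \<mu>) * (R \<bullet> X - \<mu> * (norm X)\<^sup>2)"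
    unfolding power2_norm_eq_inner g_def
    by (simp add: inner_diff_left inner_diff_right inner_add_left inner_add_right inner_commute[of R X]) algebra
  also have "\<dots> \<le> (norm (X + R))\<^sup>2"
    using assms by (simp add: X_def R_def)
  also have "X + R = (x + r) - (x' + r')" by (simp add: X_def R_def)
  finally show ?thesis .
qed

text \<open>All points are measured from the anchor \<open>y 0\<close>; \<open>f\<close> and
  \<open>1 + g\<^sup>2 * f\<close> stand for consecutive values of \<open>phi\<close>.\<close>

lemma anchored_contraction_step:
  fixes z t t' z' :: "'a::real_inner" and f g :: real
  assumes g: "g > 0" and f: "f \<ge> 0"
    and z': "(1 + g\<^sup>2 * f) *\<^sub>R z' = (g\<^sup>2 * f) *\<^sub>R t"
    and contr: "g\<^sup>2 * (norm (t' - t))\<^sup>2 \<le> (norm (z' - z))\<^sup>2"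
    and inv: "g\<^sup>2 * f * (norm (t - z))\<^sup>2 + (norm z)\<^sup>2 \<le> g\<^sup>2 * (norm t)\<^sup>2"
  shows "g\<^sup>2 * (1 + g\<^sup>2 * f) * (norm (t' - z'))\<^sup>2 + (norm z')\<^sup>2 \<le> g\<^sup>2 * (norm t')\<^sup>2"
proof -
  define h where "h = g\<^sup>2 * f"
  define p where "p = h / (1 + h)"
  have h: "h \<ge> 0" using f by (simp add: h_def)
  have p: "p \<ge> 0" "(1 + h) * p = h" using h by (auto simp: p_def)
  have z'_eq: "z' = p *\<^sub>R t"
  proof -
    have "(1 + h) *\<^sub>R z' = (1 + h) *\<^sub>R (p *\<^sub>R t)"
      using z' p by (simp add: h_def)
    then show ?thesis using h by (metis add_nonneg_pos add.commute less_irrefl scaleR_cancel_left zero_less_one)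
  qed
  have hp: "h = p + h * p" using p by (simp add: algebra_simps)
  \<comment> \<open>With the multipliers \<open>h\<close> and \<open>p\<close> every term in
    \<open>z\<close> cancels, because \<open>h = p + h * p\<close>.\<close>
  have "g\<^sup>2 * (1 + h) * (norm (t' - z'))\<^sup>2 + (norm z')\<^sup>2 - g\<^sup>2 * (norm t')\<^sup>2
      = h * (g\<^sup>2 * (norm (t' - t))\<^sup>2 - (norm (z' - z))\<^sup>2)
        + p * (h * (norm (t - z))\<^sup>2 + (norm z)\<^sup>2 - g\<^sup>2 * (norm t)\<^sup>2)"
    unfolding z'_eq power2_norm_eq_inner
    apply (simp add: inner_diff_left inner_diff_right inner_commute[of t t'] inner_commute[of z t])
    using hp by algebra
  moreover have "h * (g\<^sup>2 * (norm (t' - t))\<^sup>2 - (norm (z' - z))\<^sup>2) \<le> 0"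
    using h contr by (simp add: mult_nonneg_nonpos)
  moreover have "p * (h * (norm (t - z))\<^sup>2 + (norm z)\<^sup>2 - g\<^sup>2 * (norm t)\<^sup>2) \<le> 0"
    using p inv by (simp add: mult_nonneg_nonpos h_def)
  ultimately show ?thesis by (simp add: h_def)
qed

text \<open>Here \<open>e\<close> is the zero of \<open>A\<close> seen from the anchor,
  \<open>s\<close> the geometric sum and \<open>G\<close> the power \<open>g ^ N\<close>. Their
  relations avoid division by \<open>g - 1\<close>, so \<open>g = 1\<close> is covered.\<close>

lemma anchored_contraction_rate:
  fixes z t e :: "'a::real_inner" and f g G s :: real
  assumes g: "g \<ge> 1" and s: "s > 0" and G: "G > 0" "G - 1 = (g - 1) * s"
    and f: "(g + 1) * f = s * (G + 1)"
    and contr: "g\<^sup>2 * (norm (t - e))\<^sup>2 \<le> (norm (z - e))\<^sup>2"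
    and inv: "g\<^sup>2 * f * (norm (t - z))\<^sup>2 + (norm z)\<^sup>2 \<le> g\<^sup>2 * (norm t)\<^sup>2"
  shows "(g * s * norm (t - z))\<^sup>2 \<le> ((g + 1) * norm e)\<^sup>2"
proof -
  define w where "w = t - z"
  have t: "t = z + w" by (simp add: w_def)
  \<comment> \<open>\<open>(norm q)\<^sup>2\<close> completes the square in \<open>z\<close>.\<close>
  define q where "q = ((g - 1) * (g + 1) * s) *\<^sub>R z + (g\<^sup>2 * s) *\<^sub>R w - ((g + 1) * G) *\<^sub>R e"
  have "(g * s * norm w)\<^sup>2 * G + (norm q)\<^sup>2 - ((g + 1) * norm e)\<^sup>2 * G
     = (g + 1) * s * ((g\<^sup>2 * f * (norm w)\<^sup>2 + (norm z)\<^sup>2 - g\<^sup>2 * (norm t)\<^sup>2)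
        + G * (g\<^sup>2 * (norm (t - e))\<^sup>2 - (norm (z - e))\<^sup>2))"
    unfolding power_mult_distrib q_def t power2_norm_eq_inner
    apply (simp add: inner_diff_left inner_diff_right inner_add_left inner_add_right inner_commute[of w z] inner_commute[of e z] inner_commute[of e w])
    using G(2) f by algebra
  also have "\<dots> \<le> 0"
    using g s G contr inv by (intro mult_nonneg_nonpos add_nonpos_nonpos) (auto simp: w_def)
  finally have "(g * s * norm w)\<^sup>2 * G \<le> ((g + 1) * norm e)\<^sup>2 * G"
    using zero_le_power2[of "norm q"] by linarith
  then show ?thesis using G by (simp add: w_def)
qed

subsection \<open>The iteration\<close>

lemma phi_minus_one: "phi \<mu> (- 1) = 0"
  by (simp add: phi_def)

lemma phi_of_nat: "phi \<mu> (int n) = (\<Sum>i\<le>n. (1 + 2 * \<mu>) ^ (2 * i))"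
proof -
  have "{0..int n} = int ` {..n}"
    by (auto simp: image_iff intro!: bexI[of _ "nat _"])
  then show ?thesis by (simp add: phi_def sum.reindex)
qed

lemma phi_rec:
  assumes "k \<ge> 0"
  shows "phi \<mu> k = 1 + (1 + 2 * \<mu>)\<^sup>2 * phi \<mu> (k - 1)"
proof -
  have "phi \<mu> (int n) = 1 + (1 + 2 * \<mu>)\<^sup>2 * phi \<mu> (int n - 1)" for n
  proof (cases n)
    case (Suc m)
    then have "int n - 1 = int m" by simp
    then show ?thesis
      unfolding Suc phi_of_nat by (simp add: phi_of_nat sum.atMost_Suc_shift sum_distrib_left power_add[symmetric] power2_eq_square mult.assoc del: sum.atMost_Suc)
  qed (simp add: phi_minus_one phi_of_nat[of _ 0, simplified])
  from this[of "nat k"] assms show ?thesis by simp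
qed

lemma phi_nonneg: "\<mu> \<ge> 0 \<Longrightarrow> phi \<mu> k \<ge> 0"
  by (auto simp: phi_def intro!: sum_nonneg)

text \<open>For \<open>g \<noteq> 1\<close> this is a difference of squares split into two factors;
  the division-free form also covers \<open>\<mu> = 0\<close>.\<close>

lemma phi_geometric:
  fixes \<mu> :: real
  defines "g \<equiv> 1 + 2 * \<mu>"
  shows "(g + 1) * phi \<mu> (int n) = (\<Sum>k=0..n. g ^ k) * (g ^ Suc n + 1)"
proof (induction n)
  case 0
  then show ?case by (simp add: phi_of_nat[of _ 0, simplified])
next
  case (Suc n)
  define s where "s = (\<Sum>k=0..n. g ^ k)"
  define G where "G = g ^ Suc n"
  define f where "f = phi \<mu> (int n)"
  have "(g - 1) * s = G - 1"
    unfolding s_def G_def atLeast0AtMost lessThan_Suc_atMost[symmetric] power_diff_1_eq by simp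
  moreover have "(g + 1) * f = s * (G + 1)" using Suc by (simp only: s_def G_def f_def)
  ultimately have "(g + 1) * (f + G\<^sup>2) = (s + G) * (g * G + 1)" by algebra
  moreover have "(\<Sum>k=0..Suc n. g ^ k) = s + G" by (simp add: s_def G_def)
  moreover have "phi \<mu> (int (Suc n)) = f + G\<^sup>2"
    unfolding phi_of_nat f_def by (simp add: g_def G_def power_even_eq del: power_Suc)
  moreover have "g ^ Suc (Suc n) = g * G" by (simp add: G_def)
  ultimately show ?case by (simp only:)
qed

text \<open>Since \<open>phi \<mu> k - 1 = g\<^sup>2 * phi \<mu> (k - 1)\<close>, this is the
  Halpern step multiplied by \<open>phi \<mu> k\<close>.\<close>

lemma OS_PPM_anchored:
  fixes A :: "real ^ 'n::finite \<Rightarrow> (real ^ 'n) set"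
  assumes \<mu>: "\<mu> \<ge> 0" and xy: "OS_PPM \<mu> A x y"
  defines "g \<equiv> 1 + 2 * \<mu>"
  shows "phi \<mu> (int n) *\<^sub>R y (int n) = (phi \<mu> (int n) - 1) *\<^sub>R x (int n)
    - (g * phi \<mu> (int n - 1)) *\<^sub>R (y (int n - 1) - x (int n)) + y 0"
proof (induction n)
  case 0
  then show ?case by (simp add: phi_minus_one phi_of_nat[of _ 0, simplified])
next
  case (Suc n)
  define k where "k = int n + 1"
  have k: "k \<ge> 1" "int (Suc n) = k" "int n = k - 1" "k - 1 - 1 = k - 2" by (auto simp: k_def)
  have "phi \<mu> k > 0"
    using k phi_nonneg[OF \<mu>, of "k - 1"] by (simp add: phi_rec add_pos_nonneg)
  moreover have "y k = x k
          + ((phi \<mu> (k - 1) - 1) / phi \<mu> k) *\<^sub>R (x k - x (k - 1))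
          - (2 * \<mu> * phi \<mu> (k - 1) / phi \<mu> k) *\<^sub>R (y (k - 1) - x k)
          + ((1 + 2 * \<mu>) * phi \<mu> (k - 2) / phi \<mu> k) *\<^sub>R (y (k - 2) - x (k - 1))"
    using xy k by (simp add: OS_PPM_def)
  ultimately have "phi \<mu> k *\<^sub>R y k = phi \<mu> k *\<^sub>R x k
          + (phi \<mu> (k - 1) - 1) *\<^sub>R (x k - x (k - 1))
          - (2 * \<mu> * phi \<mu> (k - 1)) *\<^sub>R (y (k - 1) - x k)
          + (g * phi \<mu> (k - 2)) *\<^sub>R (y (k - 2) - x (k - 1))"
    by (simp add: scaleR_add_right scaleR_diff_right g_def)
  moreover note Suc[unfolded k(3,4)]
  \<comment> \<open>Adding the induction hypothesis makes the terms in \<open>x (k - 1)\<close> and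
    \<open>y (k - 2)\<close> telescope, leaving the anchor \<open>y 0\<close>.\<close>
  ultimately have "phi \<mu> k *\<^sub>R y k + phi \<mu> (k - 1) *\<^sub>R y (k - 1) =
      (phi \<mu> k *\<^sub>R x k
          + (phi \<mu> (k - 1) - 1) *\<^sub>R (x k - x (k - 1))
          - (2 * \<mu> * phi \<mu> (k - 1)) *\<^sub>R (y (k - 1) - x k)
          + (g * phi \<mu> (k - 2)) *\<^sub>R (y (k - 2) - x (k - 1)))
      + ((phi \<mu> (k - 1) - 1) *\<^sub>R x (k - 1)
          - (g * phi \<mu> (k - 2)) *\<^sub>R (y (k - 2) - x (k - 1)) + y 0)"
    by (simp only:)
  also have "\<dots> = phi \<mu> k *\<^sub>R x k + (phi \<mu> (k - 1) - 1) *\<^sub>R x k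
          - (2 * \<mu> * phi \<mu> (k - 1)) *\<^sub>R (y (k - 1) - x k) + y 0"
    by (simp add: algebra_simps)
  finally have "phi \<mu> k *\<^sub>R y k = phi \<mu> k *\<^sub>R x k + (phi \<mu> (k - 1) - 1) *\<^sub>R x k
          - (2 * \<mu> * phi \<mu> (k - 1)) *\<^sub>R (y (k - 1) - x k) + y 0 - phi \<mu> (k - 1) *\<^sub>R y (k - 1)"
    by (simp add: eq_diff_eq)
  then show ?case unfolding k(2) by (simp add: algebra_simps g_def)
qed

lemma OS_PPM_invariant:
  fixes A :: "real ^ 'n::finite \<Rightarrow> (real ^ 'n) set"
  assumes \<mu>: "\<mu> \<ge> 0" and A: "maximal_strongly_monotone \<mu> A" and xy: "OS_PPM \<mu> A x y"
  defines "g \<equiv> 1 + 2 * \<mu>"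
  defines "z \<equiv> \<lambda>k. y (k - 1) - y 0"
    and "t \<equiv> \<lambda>k. x k - (y (k - 1) - x k) /\<^sub>R g - y 0"
  shows "g\<^sup>2 * phi \<mu> (int n) * (norm (t (int n + 1) - z (int n + 1)))\<^sup>2 + (norm (z (int n + 1)))\<^sup>2
     \<le> g\<^sup>2 * (norm (t (int n + 1)))\<^sup>2"
proof (induction n)
  case 0
  \<comment> \<open>At index \<open>1\<close> the point \<open>z\<close> vanishes and the weight is
    \<open>phi \<mu> 0 = 1\<close>, so equality holds.\<close>
  then show ?case by (simp add: z_def phi_of_nat[of _ 0, simplified])
next
  case (Suc n)
  define k where "k = int n + 1"
  have k: "k \<ge> 1" "int (Suc n) = k" "int n = k - 1" by (auto simp: k_def)
  have g: "g > 0" using \<mu> by (simp add: g_def)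
  have phi: "phi \<mu> k = 1 + g\<^sup>2 * phi \<mu> (k - 1)" using k by (simp add: phi_rec g_def)
  have "x j = resolvent A (y (j - 1))" if "j \<ge> 1" for j
    using xy that by (simp add: OS_PPM_def)
  then have res: "y (j - 1) - x j \<in> A (x j)" if "j \<ge> 1" for j
    using resolvent_residual_mem[OF \<mu> A] that by simp
  have "\<mu> * (norm (x (k + 1) - x k))\<^sup>2 \<le> (y (k + 1 - 1) - x (k + 1) - (y (k - 1) - x k)) \<bullet> (x (k + 1) - x k)"
    using A res[of k] res[of "k + 1"] k
    by (simp add: maximal_strongly_monotone_def strongly_monotone_def)
  note reflected_resolvent_contraction[OF \<mu> this]
  moreover have t_diff: "t (k + 1) - t k = x (k + 1) - (y (k + 1 - 1) - x (k + 1)) /\<^sub>R g - (x k - (y (k - 1) - x k) /\<^sub>R g)"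
    unfolding t_def by simp
  ultimately have contr: "g\<^sup>2 * (norm (t (k + 1) - t k))\<^sup>2 \<le> (norm (z (k + 1) - z k))\<^sup>2"
    unfolding t_diff by (simp add: z_def g_def)
  have anchor: "phi \<mu> k *\<^sub>R y k = (phi \<mu> k - 1) *\<^sub>R x k - (g * phi \<mu> (k - 1)) *\<^sub>R (y (k - 1) - x k) + y 0"
    using OS_PPM_anchored[OF \<mu> xy, of "Suc n"] unfolding k(2) g_def .
  have g_inv: "g\<^sup>2 * phi \<mu> (k - 1) * inverse g = g * phi \<mu> (k - 1)"
    using g by (simp add: power2_eq_square)
  have t_eq: "(phi \<mu> k - 1) *\<^sub>R t k = (phi \<mu> k - 1) *\<^sub>R x k - (g * phi \<mu> (k - 1)) *\<^sub>R (y (k - 1) - x k) - (phi \<mu> k - 1) *\<^sub>R y 0"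
    by (simp add: t_def phi scaleR_diff_right g_inv)
  have "phi \<mu> k *\<^sub>R z (k + 1) = phi \<mu> k *\<^sub>R y k - phi \<mu> k *\<^sub>R y 0"
    by (simp add: z_def scaleR_diff_right)
  also have "\<dots> = (phi \<mu> k - 1) *\<^sub>R t k"
    unfolding anchor t_eq by (simp add: algebra_simps)
  finally have "(1 + g\<^sup>2 * phi \<mu> (k - 1)) *\<^sub>R z (k + 1) = (g\<^sup>2 * phi \<mu> (k - 1)) *\<^sub>R t k"
    by (simp add: phi)
  from anchored_contraction_step[OF g phi_nonneg[OF \<mu>] this contr] Suc k
  show ?case by (simp add: phi)
qed

theorem theorem3p2:
  fixes A :: "real ^ 'n::finite \<Rightarrow> (real ^ 'n) set"
    and \<mu> :: real
    and x y :: "int \<Rightarrow> real ^ 'n"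
    and x_star :: "real ^ 'n"
    and N :: nat
  assumes "\<mu> \<ge> 0"
    and "maximal_strongly_monotone \<mu> A"
    and "x_star \<in> Zer A"
    and "OS_PPM \<mu> A x y"
    and "N \<ge> 1"
  shows "(norm (y (int N - 1) - x (int N)))\<^sup>2
           \<le> (1 / (\<Sum>k = 0..N - 1. (1 + 2 * \<mu>) ^ k))\<^sup>2 * (norm (y 0 - x_star))\<^sup>2"
proof -
  obtain n where N: "N = Suc n" using assms(5) by (cases N) auto
  define g where "g = 1 + 2 * \<mu>"
  define s where "s = (\<Sum>k = 0..n. g ^ k)"
  define r where "r = y (int N - 1) - x (int N)"
  define z where "z = y (int N - 1) - y 0"
  define t where "t = x (int N) - r /\<^sub>R g - y 0"
  have g: "g \<ge> 1" using assms(1) by (simp add: g_def)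
  have s: "s > 0" unfolding s_def using g by (intro sum_pos) auto
  have G: "g ^ Suc n - 1 = (g - 1) * s"
    unfolding s_def atLeast0AtMost lessThan_Suc_atMost[symmetric] power_diff_1_eq ..
  have f: "(g + 1) * phi \<mu> (int n) = s * (g ^ Suc n + 1)"
    unfolding s_def g_def by (rule phi_geometric)
  have inv: "g\<^sup>2 * phi \<mu> (int n) * (norm (t - z))\<^sup>2 + (norm z)\<^sup>2 \<le> g\<^sup>2 * (norm t)\<^sup>2"
    using OS_PPM_invariant[OF assms(1,2,4), of n]
    by (simp add: t_def z_def r_def N g_def add.commute)
  have "x (int N) = resolvent A (y (int N - 1))"
    using assms(4,5) by (simp add: OS_PPM_def)
  then have "r \<in> A (x (int N))"
    using resolvent_residual_mem[OF assms(1,2)] by (simp add: r_def)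
  \<comment> \<open>The residual \<open>0\<close> at \<open>x_star\<close> makes it a fixed point of
    the contraction, which supplies \<open>e = x_star - y 0\<close>.\<close>
  then have "\<mu> * (norm (x (int N) - x_star))\<^sup>2 \<le> (r - 0) \<bullet> (x (int N) - x_star)"
    using assms(2,3) unfolding maximal_strongly_monotone_def strongly_monotone_def Zer_def by blast
  note reflected_resolvent_contraction[OF assms(1) this]
  moreover have t_diff: "t - (x_star - y 0) = x (int N) - r /\<^sub>R g - x_star"
    unfolding t_def by simp
  ultimately have contr: "g\<^sup>2 * (norm (t - (x_star - y 0)))\<^sup>2 \<le> (norm (z - (x_star - y 0)))\<^sup>2"
    unfolding t_diff by (simp add: z_def r_def g_def)
  have "(g * s * norm (t - z))\<^sup>2 \<le> ((g + 1) * norm (x_star - y 0))\<^sup>2"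
    using g by (intro anchored_contraction_rate[OF g s _ G f contr inv]) simp
  \<comment> \<open>The stretch factor \<open>1 + 1 / g\<close> times \<open>g\<close> is
    \<open>g + 1\<close>, which cancels against the same factor on the right of the rate.\<close>
  moreover have "t - z = - ((1 + 1 / g) *\<^sub>R r)"
    by (simp add: t_def z_def r_def algebra_simps inverse_eq_divide)
  then have norm_t_z: "norm (t - z) = (1 + 1 / g) * norm r"
    using g by simp
  have "g * s * norm (t - z) = (g + 1) * (s * norm r)"
    unfolding norm_t_z using g by (simp add: field_simps)
  ultimately have "s * norm r \<le> norm (y 0 - x_star)"
    using g s by (simp add: abs_le_square_iff[symmetric] abs_mult norm_minus_commute)
  then have "norm r \<le> 1 / s * norm (y 0 - x_star)"
    using s by (simp add: field_simps)
  then have "(norm r)\<^sup>2 \<le> (1 / s * norm (y 0 - x_star))\<^sup>2"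
    by (intro power_mono) auto
  then show ?thesis
    unfolding power_mult_distrib by (simp add: r_def s_def g_def N)
qed

end
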